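(* Let $\ell > m > 0$ be fixed integers with $\gcd(\ell,m)=1$, let $n$ be a positive integer, and let $X_n, Y_n, Z_n$ be the auxiliary polynomials attached to $(\ell,m)$ (defined in the context). If $(x, x+m, x+\ell) \in \mathbb{N}^3$ satisfies the Fermat equation, i.e. $x^n + (x+m)^n = (x+\ell)^n$, then $X_n$, $Y_n$, and $Z_n$ are reducible (over $\mathbb{Z}$).
   Context: $\mathbb{N}$ denotes the set of positive integers. For integers $\ell > m > 0$ and a positive integer $n$, define monic polynomials in $\mathbb{Z}[t]$ by $$X_n(t) := t^n - \sum_{k=1}^{n} \binom{n}{k} t^{n-k} (\ell-m) Q_k(\ell,m),$$ $$Y_n(t) := t^n + \sum_{k=1}^{n} (-1)^k \binom{n}{k} t^{n-k}\, \ell\, Q_k(m, m-\ell),$$ $$Z_n(t) := t^n + \sum_{k=1}^{n} (-1)^k \binom{n}{k} t^{n-k} \left(\ell^k + (\ell-m)^k\right),$$ where, for integers $a \neq b$ and $k \ge 1$, $Q_k(a,b) := \frac{a^k - b^k}{a-b} = \sum_{i=0}^{k-1} a^{k-1-i} b^i$. A polynomial $f \in \mathbb{Z}[t]$ is called reducible (over $\mathbb{Z}$) if $f = gh$ with $g,h \in \mathbb{Z}[t]$ both of positive degree; otherwise it is called irreducible (over $\mathbb{Z}$).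
   Formalization: The formal theorem assumes n ≥ 2 instead of n a positive integer: for n = 1 the claim is false, e.g. ℓ = 2, m = 1, x = 1 gives 1 + 2 = 3, while X_1 = t − 1, Y_1 = t − 2, Z_1 = t − 3 are linear and hence irreducible. *)

theory Defs
  imports "HOL-Computational_Algebra.Polynomial"
begin

(* Only meaningful for a \<noteq> b; the division is exact, see Q_mult and Q_eq_sum. *)
definition Q :: "nat \<Rightarrow> int \<Rightarrow> int \<Rightarrow> int" where
  "Q k a b = (a ^ k - b ^ k) div (a - b)"

lemma Q_mult: "(a - b) * Q k a b = a ^ k - b ^ k"
  using power_diff_sumr2 [of a k b] by (simp add: Q_def)

lemma Q_eq_sum:
  assumes "a \<noteq> b"
  shows "Q k a b = (\<Sum>i<k. a ^ (k - 1 - i) * b ^ i)"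
proof -
  have "(a - b) * Q k a b = - (b ^ k - a ^ k)"
    by (simp add: Q_mult)
  also have "\<dots> = (a - b) * (\<Sum>i<k. a ^ (k - 1 - i) * b ^ i)"
    by (subst power_diff_sumr2) (simp add: algebra_simps)
  finally show ?thesis
    using assms by simp
qed

definition X_poly :: "int \<Rightarrow> int \<Rightarrow> nat \<Rightarrow> int poly" where
  "X_poly l m n = monom 1 n
     - (\<Sum>k=1..n. monom (int (n choose k) * ((l - m) * Q k l m)) (n - k))"

definition Y_poly :: "int \<Rightarrow> int \<Rightarrow> nat \<Rightarrow> int poly" where
  "Y_poly l m n = monom 1 n
     + (\<Sum>k=1..n. monom ((-1) ^ k * int (n choose k) * (l * Q k m (m - l))) (n - k))"

definition Z_poly :: "int \<Rightarrow> int \<Rightarrow> nat \<Rightarrow> int poly" where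
  "Z_poly l m n = monom 1 n
     + (\<Sum>k=1..n. monom ((-1) ^ k * int (n choose k) * (l ^ k + (l - m) ^ k)) (n - k))"

(* Both factors must be non-constant; constant factors do not count. This is therefore not the
   negation of the library's irreducible, for which 2 * [:0, 1:] is not irreducible. *)
definition reducible_over_Z :: "int poly \<Rightarrow> bool" where
  "reducible_over_Z f \<longleftrightarrow> (\<exists>g h. f = g * h \<and> degree g > 0 \<and> degree h > 0)"

(* Linear polynomials are never reducible. For n = 1 the equation x + (x + m) = x + l has the
   solution x = l - m, positive since l > m, while X_poly, Y_poly and Z_poly are linear.
   Reducibility for every solution can therefore only be claimed for n >= 2. *)
lemma degree_1_not_reducible_over_Z: "degree f = 1 \<Longrightarrow> \<not> reducible_over_Z f"
  by (auto simp: reducible_over_Z_def)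
     (metis One_nat_def add_is_1 degree_0 degree_mult_eq less_numeral_extra(3) mult_zero_left
       mult_zero_right)

end

theory Submission
  imports Defs
begin

text \<open>
  By the binomial theorem the three polynomials are the Fermat equation itself in disguise:
  \<open>X(t) = t^n + (t + m)^n - (t + l)^n\<close>, \<open>Y(t) = X(t - m)\<close> and
  \<open>Z(t) = X(t - l)\<close>. A solution therefore gives them the integer roots
  \<open>x\<close>, \<open>x + m\<close>, \<open>x + l\<close>, and each splits off a linear factor.
\<close>

text \<open>The term for k = 0 is split off because the sums defining the three polynomials start at
  k = 1.\<close>

lemma binomial_split_first:
  fixes a b :: "'a::comm_ring_1"
  shows "(a + b) ^ n = a ^ n + (\<Sum>k=1..n. of_nat (n choose k) * b ^ k * a ^ (n - k))"
proof -
  have "(a + b) ^ n = (\<Sum>k=0..n. of_nat (n choose k) * b ^ k * a ^ (n - k))"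
    by (subst add.commute) (simp add: binomial_ring atMost_atLeast0)
  then show ?thesis
    by (simp add: sum.atLeast_Suc_atMost)
qed

lemma degree_monic_sum:
  fixes c :: "nat \<Rightarrow> 'a::comm_ring_1"
  shows "degree (monom 1 n + (\<Sum>k=1..n. monom (c k) (n - k))) = n"
\<comment> \<open>The terms of the sum have degree at most n - 1, which is below n only for n > 0;
  for n = 0 the sum is empty.\<close>
proof (cases "n = 0")
  case False
  have "degree (\<Sum>k=1..n. monom (c k) (n - k)) \<le> n - 1"
    by (rule degree_sum_le) (auto intro: order.trans [OF degree_monom_le])
  with False show ?thesis
    by (subst degree_add_eq_left) (auto simp: degree_monom_eq)
qed simp

text \<open>The root splits off a monic linear factor, and degree at least 2 leaves a non-constant
  cofactor.\<close>

lemma reducible_over_Z_if_root: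
  assumes "poly f a = 0" "degree f \<ge> 2"
  shows "reducible_over_Z f"
proof -
  obtain h where h: "f = [:-a, 1:] * h"
    using assms(1) by (auto simp: poly_eq_0_iff_dvd)
  with assms(2) have "h \<noteq> 0"
    by auto
  then have "degree f = Suc (degree h)"
    unfolding h by (subst degree_mult_eq) auto
  with assms(2) h show ?thesis
    unfolding reducible_over_Z_def by (intro exI [of _ "[:-a, 1:]"] exI [of _ h]) auto
qed

text \<open>By \<open>Q_mult\<close> the factor l - m clears the denominator of \<open>Q\<close>, so
  the sum is a difference of two binomial expansions without their leading terms.\<close>

lemma poly_X_poly: "poly (X_poly l m n) t = t ^ n + (t + m) ^ n - (t + l) ^ n"
  using binomial_split_first [of t m n] binomial_split_first [of t l n]
  unfolding X_poly_def Q_mult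
  by (simp add: poly_sum poly_monom sum_subtractf algebra_simps)

lemma poly_Y_poly: "poly (Y_poly l m n) t = (t - m) ^ n + t ^ n - (t - m + l) ^ n"
proof -
  \<comment> \<open>Here l = m - (m - l) clears the denominator of \<open>Q\<close>, and the sign
    (-1)^k is absorbed into the bases -m and l - m.\<close>
  have term_eq: "(-1) ^ k * int (n choose k) * (l * Q k m (m - l)) * t ^ (n - k)
      = int (n choose k) * (- m) ^ k * t ^ (n - k)
        - int (n choose k) * (l - m) ^ k * t ^ (n - k)" for k
  proof -
    have "l * Q k m (m - l) = m ^ k - (m - l) ^ k"
      using Q_mult [of m "m - l" k] by simp
    moreover have "(l - m) ^ k = (-1) ^ k * (m - l) ^ k"
      using power_minus [of "m - l" k] by simp
    ultimately show ?thesis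
      by (simp only: power_minus [of m k]) (simp add: algebra_simps)
  qed
  show ?thesis
    using binomial_split_first [of t "- m" n] binomial_split_first [of t "l - m" n]
    by (simp only: Y_poly_def poly_add poly_sum poly_monom term_eq sum_subtractf)
      (simp add: algebra_simps)
qed

text \<open>The sum contains the expansions of (t - l)^n and (t - l + m)^n, each without its t^n;
  the single t^n in front replaces only one of them, hence the final -t^n.\<close>

lemma poly_Z_poly: "poly (Z_poly l m n) t = (t - l) ^ n + (t - l + m) ^ n - t ^ n"
proof -
  have "(-1) ^ k * int (n choose k) * (l ^ k + (l - m) ^ k) * t ^ (n - k)
      = int (n choose k) * (- l) ^ k * t ^ (n - k)
        + int (n choose k) * (m - l) ^ k * t ^ (n - k)" for k
    using power_minus [of l k] power_minus [of "l - m" k]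
    by (simp add: algebra_simps)
  then show ?thesis
    using binomial_split_first [of t "- l" n] binomial_split_first [of t "m - l" n]
    by (simp add: Z_poly_def poly_sum poly_monom sum.distrib algebra_simps)
qed

lemma degree_X_poly: "degree (X_poly l m n) = n"
  \<comment> \<open>The minus sign before the sum moves into the coefficients.\<close>
  using degree_monic_sum [of n "\<lambda>k. - (int (n choose k) * ((l - m) * Q k l m))"]
  by (simp add: X_poly_def minus_monom [symmetric] sum_negf)

lemma degree_Y_poly: "degree (Y_poly l m n) = n"
  unfolding Y_poly_def by (rule degree_monic_sum)

lemma degree_Z_poly: "degree (Z_poly l m n) = n"
  unfolding Z_poly_def by (rule degree_monic_sum)

theorem corollary5:
  fixes l m x :: int and n :: nat
  assumes "l > m" and "m > 0" and "gcd l m = 1"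
    and "n \<ge> 2"
    and "x > 0" and "x + m > 0" and "x + l > 0"
    and "x ^ n + (x + m) ^ n = (x + l) ^ n"
  shows "reducible_over_Z (X_poly l m n) \<and> reducible_over_Z (Y_poly l m n)
       \<and> reducible_over_Z (Z_poly l m n)"
proof (intro conjI)
  show "reducible_over_Z (X_poly l m n)"
    by (rule reducible_over_Z_if_root [where a = x])
       (use assms in \<open>simp_all add: poly_X_poly degree_X_poly\<close>)
  show "reducible_over_Z (Y_poly l m n)"
    \<comment> \<open>At t = x + m the bases t - m, t, t - m + l become x, x + m, x + l.\<close>
    by (rule reducible_over_Z_if_root [where a = "x + m"])
       (use assms in \<open>simp_all add: poly_Y_poly degree_Y_poly\<close>)
  show "reducible_over_Z (Z_poly l m n)"
    by (rule reducible_over_Z_if_root [where a = "x + l"])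
       (use assms in \<open>simp_all add: poly_Z_poly degree_Z_poly\<close>)
qed

end
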